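(* Let $k,\ell$ be integers with $k<\ell<\sqrt3k$ such that either (a) $k,\ell$ are odd and $\gcd(k,\ell)=1$, or (b) $k,\ell$ are even, $\gcd(k,\ell)=2$ and $8\mid k\ell$. Then there exist positive integers $d_1,d_2$ such that $d=d_1d_2$ is squarefree, $d\equiv1\pmod 4$, $d_1<d_2<3d_1$ and $k^2d_2-\ell^2d_1=\pm4$. Moreover, if $(d_1',d_2',k,\ell)$ is any tuple of integers with $d_1',d_2'>0$, $d_1'd_2'$ squarefree, $d_1'd_2'\equiv1\pmod 4$, $d_1'<d_2'<3d_1'$ and $k^2d_2'-\ell^2d_1'=\pm4$, then for infinitely many integers $n$ the tuple $(d_1'',d_2'',k,\ell)$ satisfies the same conditions, where $d_1''=d_1'+2k^2n$, $d_2''=d_2'+2\ell^2n$ if $k,\ell$ are odd, and $d_1''=d_1'+k^2n$, $d_2''=d_2'+\ell^2n$ if $k,\ell$ are even. *)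

theory Defs
  imports Complex_Main "HOL-Computational_Algebra.Squarefree" "HOL-Number_Theory.Cong"
begin

definition good_tuple :: "int \<Rightarrow> int \<Rightarrow> int \<Rightarrow> int \<Rightarrow> bool" where
  "good_tuple d1 d2 k l \<longleftrightarrow>
     d1 > 0 \<and> d2 > 0 \<and> squarefree (d1 * d2) \<and> [d1 * d2 = 1] (mod 4) \<and>
     d1 < d2 \<and> d2 < 3 * d1 \<and>
     (k\<^sup>2 * d2 - l\<^sup>2 * d1 = 4 \<or> k\<^sup>2 * d2 - l\<^sup>2 * d1 = -4)"

end

theory Submission imports Defs begin

text \<open>
  Along the progression \<open>d1 + s k\<^sup>2 n\<close>, \<open>d2 + s l\<^sup>2 n\<close> both the equation and the congruence modulo 4
  persist, the ratio of the two terms tends to \<open>l\<^sup>2 / k\<^sup>2\<close>, which lies strictly between 1 and 3, and the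
  equation makes the terms coprime. Only squarefreeness is at stake. Both terms are odd, and for
  each odd prime \<open>p\<close> each of them is divisible by \<open>p\<^sup>2\<close> for at most one class of \<open>n\<close> modulo \<open>p\<^sup>2\<close>; as
  \<open>\<Sum> 2 / p\<^sup>2\<close> over odd \<open>p \<ge> 3\<close> is at most \<open>1/2\<close>, a union bound leaves a positive proportion of
  admissible \<open>n\<close>. The starting pair need not be squarefree or positive, so Bezout supplies one.
\<close>

section \<open>Counting multiples in progressions, and square divisors\<close>

text \<open>Since \<open>A\<close> is invertible modulo \<open>q\<close>, all solutions
  \<open>n\<close> are congruent modulo \<open>q\<close>, so each block of \<open>q\<close>
  consecutive integers holds at most one. The extra 1 pays for the last, incomplete block.\<close>

lemma card_dvd_progression_le:
  fixes u A :: int and q N :: nat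
  assumes "coprime A (int q)"
  shows "card {n\<in>{..<N}. int q dvd u + A * int n} \<le> N div q + 1"
proof -
  let ?S = "{n\<in>{..<N}. int q dvd u + A * int n}"
  have "inj_on (\<lambda>n. n div q) ?S"
  proof (rule inj_onI)
    fix m n assume m: "m \<in> ?S" and n: "n \<in> ?S" and eq: "m div q = n div q"
    have "int q dvd (u + A * int m) - (u + A * int n)"
      using m n by (intro dvd_diff) auto
    hence "int q dvd A * (int m - int n)"
      by (simp add: algebra_simps)
    hence "int q dvd int m - int n"
      using assms by (simp add: coprime_dvd_mult_right_iff coprime_commute)
    hence "[int m = int n] (mod int q)"
      by (simp add: cong_iff_dvd_diff)
    hence "[m = n] (mod q)"
      by (simp only: cong_int_iff)
    hence "m mod q = n mod q"
      by (simp only: cong_def)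
    thus "m = n"
      using eq by (metis div_mult_mod_eq)
  qed
  moreover have "(\<lambda>n. n div q) ` ?S \<subseteq> {..N div q}"
    by (auto intro!: div_le_mono)
  ultimately have "card ?S \<le> card {..N div q}"
    by (intro card_inj_on_le) auto
  thus ?thesis by simp
qed

lemma sum_inverse_odd_squares_le:
  "(\<Sum>j=1..n. 1 / (2 * real j + 1)\<^sup>2) \<le> 1 / 4"
proof -
  \<comment> \<open>Telescoping: (2j+1)^2 > 4j(j+1), so each term is at most 1/(4j) -
    1/(4(j+1)).\<close>
  have "(\<Sum>j=1..n. 1 / (2 * real j + 1)\<^sup>2) \<le> 1 / 4 - 1 / (4 * (real n + 1))"
  proof (induction n)
    case (Suc n)
    have "1 / (2 * real (Suc n) + 1)\<^sup>2 \<le> 1 / (4 * (real n + 1) * (real n + 2))"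
      by (intro frac_le mult_pos_pos) (auto simp: power2_eq_square algebra_simps)
    also have "\<dots> = 1 / (4 * (real n + 1)) - 1 / (4 * (real n + 2))"
      by (simp add: divide_simps)
    finally show ?case
      using Suc.IH by simp (simp add: algebra_simps)
  qed simp
  also have "\<dots> \<le> 1 / 4" by simp
  finally show ?thesis .
qed

text \<open>A prime whose square divides \<open>x\<close> is odd and smaller than
  \<open>2 * K\<close>. Writing it as \<open>2 * j + 1\<close> matches the index of the sum of
  inverse odd squares.\<close>

lemma not_squarefree_odd_square_dvd:
  fixes x :: int and K :: nat
  assumes "\<not> squarefree x" "odd x" "0 < x" "x < (int (2 * K))\<^sup>2"
  obtains j where "j \<in> {1..<K}" "prime (2 * j + 1)" "int ((2 * j + 1)\<^sup>2) dvd x"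
proof -
  obtain p :: int where p: "prime p" "p\<^sup>2 dvd x"
    using assms(1,3) by (auto simp: squarefree_factorial_semiring)
  have "odd p"
    using p(2) assms(2) by (auto dest: dvd_trans)
  moreover have "p > 1"
    using p(1) by (rule prime_gt_1_int)
  ultimately obtain i where i: "p = 2 * i + 1" "i \<ge> 1"
    by (auto elim!: oddE)
  define j where "j = nat i"
  have pj: "p = int (2 * j + 1)" and j1: "j \<ge> 1"
    using i by (auto simp: j_def)
  have "p\<^sup>2 \<le> x"
    using p(2) assms(3) by (rule zdvd_imp_le)
  hence "p\<^sup>2 < (int (2 * K))\<^sup>2"
    using assms(4) by simp
  hence "p < int (2 * K)"
    by (rule power_less_imp_less_base) simp
  hence "j < K"
    using pj by simp
  show ?thesis
  proof (rule that)
    show "j \<in> {1..<K}" using j1 \<open>j < K\<close> by simp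
    show "prime (2 * j + 1)" using p(1) unfolding pj by (simp only: prime_nat_int_transfer)
    show "int ((2 * j + 1)\<^sup>2) dvd x" using p(2) unfolding pj by simp
  qed
qed

section \<open>Sieving two progressions simultaneously\<close>

lemma exists_squarefree_pair:
  fixes u v A B :: int
  assumes pos: "u > 0" "v > 0" "A > 0" "B > 0"
    and ev: "even A" "even B"
    and cop: "coprime u A" "coprime v B"
  shows "\<exists>n::nat. squarefree (u + A * int n) \<and> squarefree (v + B * int n)"
proof (rule ccontr)
  assume none: "\<not> ?thesis"
  \<comment> \<open>For \<open>n < N\<close> both terms are below C N = (4C)^2, so only primes below
    4C, that is \<open>j < 2 * C\<close>, matter. The bad \<open>n\<close> then number less than N/2
    + 4C = 12C, which is below N = 16C.\<close>
  define C where "C = nat (u + v + A + B)"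
  define N where "N = 16 * C"
  have C: "int C = u + v + A + B" "C > 0"
    using pos by (auto simp: C_def)
  \<comment> \<open>Primality sits inside the set, so that \<open>j\<close> can run over a full
    interval: composite \<open>2 * j + 1\<close> contribute nothing.\<close>
  define bad where
    "bad w D j = {n\<in>{..<N}. prime (2 * j + 1) \<and> int ((2 * j + 1)\<^sup>2) dvd w + D * int n}"
    for w D :: int and j
  have catch: "\<exists>j\<in>{1..<2 * C}. n \<in> bad w D j"
    if nsf: "\<not> squarefree (w + D * int n)" and n: "n < N"
      and w: "coprime w D" "even D" "w > 0" "D > 0" "w + D \<le> int C" for w D n
  proof -
    have "odd w"
      using w(1,2) by (metis coprime_common_divisor odd_one dvd_refl)
    hence "odd (w + D * int n)"
      using w(2) by simp
    moreover have "w + D * int n < (int (2 * (2 * C)))\<^sup>2"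
    proof -
      have "w * 1 + D * int n \<le> w * int N + D * int n"
        using w(3) n by (intro add_right_mono mult_left_mono) auto
      also have "\<dots> < w * int N + D * int N"
        using w(4) n by simp
      also have "\<dots> = (w + D) * int N"
        by (simp add: algebra_simps)
      also have "\<dots> \<le> int C * int N"
        using w(5) by (intro mult_right_mono) auto
      also have "\<dots> = (int (2 * (2 * C)))\<^sup>2"
        by (simp add: N_def power2_eq_square)
      finally show ?thesis by simp
    qed
    moreover have "w + D * int n > 0"
      using w(3,4) by (simp add: add_pos_nonneg)
    ultimately obtain j where "j \<in> {1..<2 * C}" "prime (2 * j + 1)"
      "int ((2 * j + 1)\<^sup>2) dvd w + D * int n"
      using nsf not_squarefree_odd_square_dvd by blast
    thus ?thesis
      using n unfolding bad_def by blast
  qed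
  have card_bad: "real (card (bad w D j)) \<le> real N * (1 / (2 * real j + 1)\<^sup>2) + 1"
    if w: "coprime w D" for w D j
  proof (cases "bad w D j = {}")
    case False
    then obtain n where n: "prime (2 * j + 1)" "int ((2 * j + 1)\<^sup>2) dvd w + D * int n"
      by (auto simp: bad_def)
    \<comment> \<open>A prime dividing \<open>D\<close> and some term would divide \<open>w\<close>
      too, against \<open>coprime w D\<close>.\<close>
    have "coprime D (int (2 * j + 1))"
    proof (rule ccontr)
      assume "\<not> coprime D (int (2 * j + 1))"
      moreover have pr: "prime (int (2 * j + 1))"
        using n(1) by (simp only: prime_nat_int_transfer)
      ultimately have dD: "int (2 * j + 1) dvd D"
        by (metis prime_imp_coprime coprime_commute)
      have "int (2 * j + 1) dvd w + D * int n"
        using n(2) by (metis dvd_trans dvd_triv_left power2_eq_square of_nat_mult)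
      hence "int (2 * j + 1) dvd w"
        using dD by (metis dvd_add_left_iff dvd_mult2)
      hence "is_unit (int (2 * j + 1))"
        using w dD by (meson coprime_common_divisor)
      thus False using pr by (meson not_prime_unit)
    qed
    hence "coprime D (int ((2 * j + 1)\<^sup>2))"
      by simp
    hence "card {n\<in>{..<N}. int ((2 * j + 1)\<^sup>2) dvd w + D * int n} \<le> N div (2 * j + 1)\<^sup>2 + 1"
      by (rule card_dvd_progression_le)
    moreover have "card (bad w D j) \<le> card {n\<in>{..<N}. int ((2 * j + 1)\<^sup>2) dvd w + D * int n}"
      by (intro card_mono) (auto simp: bad_def)
    ultimately have "real (card (bad w D j)) \<le> real (N div (2 * j + 1)\<^sup>2) + 1"
      by linarith
    also have "\<dots> \<le> real N / real ((2 * j + 1)\<^sup>2) + 1"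
      by (intro add_right_mono of_nat_div_le_of_nat)
    finally show ?thesis by (simp add: add.commute)
  qed simp
  have "{..<N} \<subseteq> (\<Union>j\<in>{1..<2 * C}. bad u A j \<union> bad v B j)"
  proof
    fix n assume "n \<in> {..<N}"
    hence n: "n < N" by simp
    have "\<not> squarefree (u + A * int n) \<or> \<not> squarefree (v + B * int n)"
      using none by blast
    thus "n \<in> (\<Union>j\<in>{1..<2 * C}. bad u A j \<union> bad v B j)"
      using catch[of u A n] catch[of v B n] n cop ev pos C by auto
  qed
  hence "card {..<N} \<le> card (\<Union>j\<in>{1..<2 * C}. bad u A j \<union> bad v B j)"
    by (intro card_mono) (auto simp: bad_def)
  also have "\<dots> \<le> (\<Sum>j\<in>{1..<2 * C}. card (bad u A j \<union> bad v B j))"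
    by (rule card_UN_le) simp
  also have "\<dots> \<le> (\<Sum>j\<in>{1..<2 * C}. card (bad u A j) + card (bad v B j))"
    by (intro sum_mono card_Un_le)
  finally have "real N \<le> (\<Sum>j\<in>{1..<2 * C}. real (card (bad u A j)) + real (card (bad v B j)))"
    by (simp flip: of_nat_add of_nat_sum)
  also have "\<dots> \<le> (\<Sum>j\<in>{1..<2 * C}. 2 * real N * (1 / (2 * real j + 1)\<^sup>2) + 2)"
  proof (rule sum_mono)
    fix j
    show "real (card (bad u A j)) + real (card (bad v B j))
        \<le> 2 * real N * (1 / (2 * real j + 1)\<^sup>2) + 2"
      using card_bad[OF cop(1), of j] card_bad[OF cop(2), of j] by linarith
  qed
  also have "\<dots> = 2 * real N * (\<Sum>j\<in>{1..<2 * C}. 1 / (2 * real j + 1)\<^sup>2) + 2 * real (2 * C - 1)"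
    by (simp add: sum.distrib sum_distrib_left)
  also have "\<dots> \<le> 2 * real N * (1 / 4) + 2 * real (2 * C)"
  proof -
    have "{1..<2 * C} = {1..2 * C - 1}" using C(2) by auto
    thus ?thesis
      using sum_inverse_odd_squares_le[of "2 * C - 1"]
      by (intro add_mono mult_left_mono) auto
  qed
  also have "\<dots> < real N"
    using C(2) by (simp add: N_def)
  finally show False by simp
qed

section \<open>Solutions along a progression\<close>

text \<open>A common divisor of \<open>d1\<close> and \<open>c\<close> divides both products on the
  left, hence 4, yet it is odd. The cases of interest are \<open>c = k\<^sup>2\<close> and
  \<open>c = d2\<close>, and the mirror image for \<open>d2\<close> and
  \<open>l\<^sup>2\<close>.\<close>

lemma coprime_coeff_left:
  fixes k l d1 d2 c :: int
  assumes "k\<^sup>2 * d2 - l\<^sup>2 * d1 = 4 \<or> k\<^sup>2 * d2 - l\<^sup>2 * d1 = - 4" "odd d1" "c dvd k\<^sup>2 * d2"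
  shows "coprime d1 c"
proof (rule coprimeI)
  fix x assume x: "x dvd d1" "x dvd c"
  have "x dvd k\<^sup>2 * d2 - l\<^sup>2 * d1"
    using x assms(3) by (meson dvd_diff dvd_mult dvd_trans)
  hence "x dvd 2\<^sup>2"
    using assms(1) by auto
  moreover have "coprime x (2\<^sup>2)"
  proof -
    have "odd x"
      using x(1) assms(2) by (auto dest: dvd_trans)
    hence "coprime x 2" by simp
    thus ?thesis by (simp only: coprime_power_right_iff) simp
  qed
  ultimately show "is_unit x"
    by (meson coprime_common_divisor dvd_refl)
qed

text \<open>The factor \<open>s\<close> is 2 for odd and 1 for even \<open>k\<close>,
  \<open>l\<close>. The start enters only through its congruence and equation, so the lemma yields
  both existence and infinitude.\<close>

lemma infinite_good_tuples:
  fixes k l d1 d2 s :: int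
  assumes k: "0 < k" "k < l" "l\<^sup>2 < 3 * k\<^sup>2"
    and s: "s > 0" "s dvd 2" "even (s * k\<^sup>2)" "even (s * l\<^sup>2)"
    and m4: "[d1 * d2 = 1] (mod 4)"
    and eq: "k\<^sup>2 * d2 - l\<^sup>2 * d1 = 4 \<or> k\<^sup>2 * d2 - l\<^sup>2 * d1 = - 4"
  shows "infinite {n. good_tuple (d1 + s * k\<^sup>2 * n) (d2 + s * l\<^sup>2 * n) k l}"
proof -
  let ?f = "\<lambda>n. d1 + s * k\<^sup>2 * n" and ?g = "\<lambda>n. d2 + s * l\<^sup>2 * n"
  have eq': "k\<^sup>2 * ?g n - l\<^sup>2 * ?f n = k\<^sup>2 * d2 - l\<^sup>2 * d1" for n
    by (simp add: algebra_simps)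
  have m4': "[?f n * ?g n = 1] (mod 4)" for n
  proof -
    obtain a b where a: "s * k\<^sup>2 = 2 * a" and b: "s * l\<^sup>2 = 2 * b"
      using s by (auto elim!: evenE)
    \<comment> \<open>The cross terms are regrouped around the left side of the equation, which is 4
      or -4; the rest is divisible by 4 because both step sizes are even.\<close>
    have "?f n * ?g n - d1 * d2 = s * n * (k\<^sup>2 * d2 - l\<^sup>2 * d1) + 2 * n * d1 * (s * l\<^sup>2)
        + (s * k\<^sup>2) * (s * l\<^sup>2) * n\<^sup>2"
      by (simp add: algebra_simps power2_eq_square)
    also have "\<dots> = s * n * (k\<^sup>2 * d2 - l\<^sup>2 * d1) + 4 * (n * d1 * b + a * b * n\<^sup>2)"
      by (simp add: a b algebra_simps)
    also have "4 dvd \<dots>"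
      using eq by (auto intro!: dvd_add)
    finally have "[?f n * ?g n = d1 * d2] (mod 4)"
      by (simp add: cong_iff_dvd_diff)
    thus ?thesis
      using m4 by (rule cong_trans)
  qed
  have odd: "odd (?f n)" "odd (?g n)" for n
  proof -
    have "4 dvd ?f n * ?g n - 1"
      using m4'[of n] by (simp add: cong_iff_dvd_diff)
    hence "even (?f n * ?g n - 1)"
      by (rule dvd_trans[rotated]) simp
    thus "odd (?f n)" "odd (?g n)" by auto
  qed
  have eqn: "k\<^sup>2 * ?g n - l\<^sup>2 * ?f n = 4 \<or> k\<^sup>2 * ?g n - l\<^sup>2 * ?f n = - 4" for n
    using eq by (simp only: eq')
  have eqn': "l\<^sup>2 * ?f n - k\<^sup>2 * ?g n = 4 \<or> l\<^sup>2 * ?f n - k\<^sup>2 * ?g n = - 4" for n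
    using eqn[of n] by linarith
  have cop_s: "coprime x s" if "odd x" for x
  proof -
    have "coprime x 2" using that by simp
    thus ?thesis using s(2) by (metis coprime_divisors dvd_refl)
  qed
  have cop_f: "coprime (?f n) (s * k\<^sup>2)" for n
    using cop_s[OF odd(1)] coprime_coeff_left[OF eqn odd(1), of "k\<^sup>2"] by simp
  have cop_g: "coprime (?g n) (s * l\<^sup>2)" for n
    using cop_s[OF odd(2)] coprime_coeff_left[OF eqn' odd(2), of "l\<^sup>2"] by simp
  have cop_fg: "coprime (?f n) (?g n)" for n
    by (rule coprime_coeff_left[OF eqn odd(1)]) simp
  have kl: "k\<^sup>2 < l\<^sup>2"
    using k by (intro power_strict_mono) auto
  \<comment> \<open>Each of \<open>?f n\<close>, \<open>?g n - ?f n\<close> and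
    \<open>3 * ?f n - ?g n\<close> has slope at least 1, and \<open>M\<close> exceeds the absolute
    values of their constant terms.\<close>
  define M where "M = 3 * \<bar>d1\<bar> + \<bar>d2\<bar> + 1"
  have ge: "x * n \<ge> n" if "x > 0" "n \<ge> 0" for x n :: int
    using mult_right_mono[of 1 x n] that by simp
  have range: "?f n > 0" "?g n > 0" "?f n < ?g n" "?g n < 3 * ?f n" if n: "n \<ge> M" for n
  proof -
    have n0: "n \<ge> 0" using n by (simp add: M_def)
    have "s * k\<^sup>2 * n \<ge> n" "s * (l\<^sup>2 - k\<^sup>2) * n \<ge> n" "s * (3 * k\<^sup>2 - l\<^sup>2) * n \<ge> n"
      using s(1) k kl n0 by (auto intro!: ge mult_pos_pos)
    thus "?f n > 0" and lt: "?f n < ?g n" and "?g n < 3 * ?f n"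
      using n unfolding M_def by (auto simp: algebra_simps)
    thus "?g n > 0" by linarith
  qed
  have unbounded: "\<exists>n>b. good_tuple (?f n) (?g n) k l" for b
  proof -
    \<comment> \<open>Restarting the progression at \<open>m\<close> makes its terms positive, as
      the sieve requires, and puts every later index beyond \<open>b\<close>.\<close>
    define m where "m = max M (b + 1)"
    have "\<exists>i::nat. squarefree (?f m + s * k\<^sup>2 * int i) \<and> squarefree (?g m + s * l\<^sup>2 * int i)"
      using k s range[of m] cop_f[of m] cop_g[of m]
      by (intro exists_squarefree_pair) (auto simp: m_def)
    then obtain i :: nat where "squarefree (?f m + s * k\<^sup>2 * int i)"
      "squarefree (?g m + s * l\<^sup>2 * int i)" by blast
    hence sf: "squarefree (?f (m + int i))" "squarefree (?g (m + int i))"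
      by (simp_all only: distrib_left add.assoc)
    have "m + int i \<ge> M" "m + int i > b"
      by (auto simp: m_def)
    moreover have "good_tuple (?f (m + int i)) (?g (m + int i)) k l"
      unfolding good_tuple_def
      using range[OF \<open>m + int i \<ge> M\<close>] m4' eqn squarefree_mult_coprime[OF cop_fg sf] by blast
    ultimately show ?thesis by blast
  qed
  show ?thesis
  proof
    assume "finite {n. good_tuple (?f n) (?g n) k l}"
    hence "bdd_above {n. good_tuple (?f n) (?g n) k l}"
      by (rule bdd_above_finite)
    then obtain b where b: "\<forall>n\<in>{n. good_tuple (?f n) (?g n) k l}. n \<le> b"
      unfolding bdd_above_def by blast
    obtain n where n: "n > b" "good_tuple (?f n) (?g n) k l"
      using unbounded by blast
    have "n \<le> b"
      using b n(2) by blast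
    thus False
      using n(1) by simp
  qed
qed

section \<open>Initial solutions from Bezout\<close>

text \<open>Four times a Bezout identity gives the solution \<open>(- 4 * y, 4 * x)\<close>. Adding
  the homogeneous solution \<open>(k\<^sup>2, l\<^sup>2)\<close> turns the product into an odd
  square modulo 4.\<close>

lemma exists_solution_odd:
  fixes k l :: int
  assumes "odd k" "odd l" "coprime k l"
  shows "\<exists>d1 d2. [d1 * d2 = 1] (mod 4) \<and> k\<^sup>2 * d2 - l\<^sup>2 * d1 = 4"
proof -
  have "coprime (k\<^sup>2) (l\<^sup>2)"
    using assms(3) by simp
  then obtain x y where xy: "k\<^sup>2 * x + l\<^sup>2 * y = 1"
    by (metis bezout_int coprime_imp_gcd_eq_1 mult.commute)
  obtain a b where ab: "k = 2 * a + 1" "l = 2 * b + 1"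
    using assms by (auto elim!: oddE)
  have "(k\<^sup>2 - 4 * y) * (l\<^sup>2 + 4 * x) - 1 = 4 * (k\<^sup>2 * x - y * l\<^sup>2 - 4 * y * x
      + (a\<^sup>2 + a) * l\<^sup>2 + b\<^sup>2 + b)"
    unfolding ab by (simp add: algebra_simps power2_eq_square)
  hence "[(k\<^sup>2 - 4 * y) * (l\<^sup>2 + 4 * x) = 1] (mod 4)"
    by (simp add: cong_iff_dvd_diff)
  moreover have "k\<^sup>2 * (l\<^sup>2 + 4 * x) - l\<^sup>2 * (k\<^sup>2 - 4 * y) = 4"
    using xy by (simp add: algebra_simps)
  ultimately show ?thesis by blast
qed

text \<open>If \<open>a\<close> is even then \<open>d1\<close> is odd, and adding multiples of \<open>(a\<^sup>2, b\<^sup>2)\<close> to \<open>(d1, d2)\<close> fixes \<open>d1\<close>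
  modulo 4 while moving \<open>d2\<close> through all classes modulo 4.\<close>

lemma exists_solution_one_even:
  fixes a b :: int
  assumes "even a" "coprime a b"
  shows "\<exists>d1 d2. [d1 * d2 = 1] (mod 4) \<and> a\<^sup>2 * d2 - b\<^sup>2 * d1 = 1"
proof -
  have "coprime (a\<^sup>2) (b\<^sup>2)"
    using assms(2) by simp
  then obtain x y where xy: "a\<^sup>2 * x + b\<^sup>2 * y = 1"
    by (metis bezout_int coprime_imp_gcd_eq_1 mult.commute)
  obtain c where c: "a = 2 * c" using assms(1) by (auto elim!: evenE)
  have b2y: "b\<^sup>2 * y = 1 - 4 * (c\<^sup>2 * x)"
    using xy unfolding c by (simp add: power2_eq_square)
  \<comment> \<open>Modulo 4, \<open>b\<^sup>2 * y\<close> is 1 and \<open>d1 * d2\<close> is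
    \<open>- t - x * y\<close>; this \<open>t\<close> makes it 1.\<close>
  define t where "t = - 1 - x * y"
  define d1 d2 where "d1 = a\<^sup>2 * t - y" and "d2 = b\<^sup>2 * t + x"
  have "d1 * d2 - 1 = 4 * (c\<^sup>2 * t * d2) - t * (b\<^sup>2 * y) - x * y - 1"
    by (simp add: d1_def d2_def c algebra_simps power2_eq_square)
  also have "\<dots> = 4 * (c\<^sup>2 * t * (d2 + x))"
    unfolding b2y by (simp add: t_def algebra_simps)
  finally have "[d1 * d2 = 1] (mod 4)"
    by (simp add: cong_iff_dvd_diff)
  moreover have "a\<^sup>2 * d2 - b\<^sup>2 * d1 = 1"
    using xy by (simp add: d1_def d2_def algebra_simps)
  ultimately show ?thesis by blast
qed

text \<open>Halving \<open>k\<close> and \<open>l\<close> leaves coprime \<open>a\<close>,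
  \<open>b\<close> and right side 1 or -1; divisibility by 8 makes one of them even. Which one
  decides the sign, since an even \<open>b\<close> exchanges the roles.\<close>

lemma exists_solution_even:
  fixes k l :: int
  assumes "even k" "even l" "gcd k l = 2" "8 dvd k * l"
  shows "\<exists>d1 d2. [d1 * d2 = 1] (mod 4) \<and>
           (k\<^sup>2 * d2 - l\<^sup>2 * d1 = 4 \<or> k\<^sup>2 * d2 - l\<^sup>2 * d1 = - 4)"
proof -
  obtain a b where ab: "k = 2 * a" "l = 2 * b"
    using assms(1,2) by (auto elim!: evenE)
  have "2 * gcd a b = gcd k l"
    using gcd_mult_distrib_int[of 2 a b] by (simp add: ab)
  hence cop: "coprime a b"
    using assms(3) by (simp add: coprime_iff_gcd_eq_1)
  have "4 * 2 dvd 4 * (a * b)"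
    using assms(4) by (simp add: ab algebra_simps)
  hence "even (a * b)"
    by (simp only: dvd_mult_cancel_left) simp
  then consider "even a" | "even b" by auto
  thus ?thesis
  proof cases
    case 1
    then obtain d1 d2 where "[d1 * d2 = 1] (mod 4)" "a\<^sup>2 * d2 - b\<^sup>2 * d1 = 1"
      using exists_solution_one_even[OF _ cop] by blast
    moreover from this have "k\<^sup>2 * d2 - l\<^sup>2 * d1 = 4"
      by (simp add: ab power2_eq_square)
    ultimately show ?thesis by blast
  next
    case 2
    then obtain d1 d2 where "[d2 * d1 = 1] (mod 4)" "b\<^sup>2 * d1 - a\<^sup>2 * d2 = 1"
      using exists_solution_one_even[of b a] cop by (auto simp: coprime_commute)
    moreover from this have "k\<^sup>2 * d2 - l\<^sup>2 * d1 = - 4"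
      by (simp add: ab power2_eq_square)
    ultimately show ?thesis by (metis mult.commute)
  qed
qed

theorem theorem5p9:
  fixes k l :: int
  assumes "k < l" and "real_of_int l < sqrt 3 * real_of_int k"
    and "(odd k \<and> odd l \<and> gcd k l = 1) \<or>
         (even k \<and> even l \<and> gcd k l = 2 \<and> 8 dvd k * l)"
  shows "(\<exists>d1 d2 :: int. good_tuple d1 d2 k l) \<and>
         (\<forall>d1 d2 :: int. good_tuple d1 d2 k l \<longrightarrow>
            (odd k \<and> odd l \<longrightarrow>
               infinite {n :: int. good_tuple (d1 + 2 * k\<^sup>2 * n) (d2 + 2 * l\<^sup>2 * n) k l}) \<and>
            (even k \<and> even l \<longrightarrow>
               infinite {n :: int. good_tuple (d1 + k\<^sup>2 * n) (d2 + l\<^sup>2 * n) k l}))"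
proof -
  have k: "k > 0"
  proof (rule ccontr)
    assume "\<not> k > 0"
    \<comment> \<open>For \<open>k \<le> 0\<close> the bounds would give l < sqrt 3 k \<le>
      k.\<close>
    hence "sqrt 3 * real_of_int k \<le> 1 * real_of_int k"
      by (intro mult_right_mono_neg) auto
    thus False using assms(1,2) by simp
  qed
  have "(real_of_int l)\<^sup>2 < (sqrt 3 * real_of_int k)\<^sup>2"
    using assms(1,2) k by (intro power_strict_mono) auto
  hence "real_of_int (l\<^sup>2) < real_of_int (3 * k\<^sup>2)"
    by (simp add: power_mult_distrib)
  hence l: "l\<^sup>2 < 3 * k\<^sup>2"
    by (simp only: of_int_less_iff)
  have inf_odd: "infinite {n. good_tuple (d1 + 2 * k\<^sup>2 * n) (d2 + 2 * l\<^sup>2 * n) k l}"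
    if "[d1 * d2 = 1] (mod 4)" "k\<^sup>2 * d2 - l\<^sup>2 * d1 = 4 \<or> k\<^sup>2 * d2 - l\<^sup>2 * d1 = - 4" for d1 d2
    using infinite_good_tuples[OF k assms(1) l, of 2 d1 d2] that by simp
  have inf_even: "infinite {n. good_tuple (d1 + k\<^sup>2 * n) (d2 + l\<^sup>2 * n) k l}"
    if "even k" "even l"
      "[d1 * d2 = 1] (mod 4)" "k\<^sup>2 * d2 - l\<^sup>2 * d1 = 4 \<or> k\<^sup>2 * d2 - l\<^sup>2 * d1 = - 4" for d1 d2
    using infinite_good_tuples[OF k assms(1) l, of 1 d1 d2] that by simp
  have "\<exists>d1 d2. good_tuple d1 d2 k l"
  proof (cases "even k")
    case False
    hence "odd k" "odd l" "coprime k l"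
      using assms(3) by (simp_all add: coprime_iff_gcd_eq_1)
    from exists_solution_odd[OF this]
    obtain d1 d2 where "[d1 * d2 = 1] (mod 4)" "k\<^sup>2 * d2 - l\<^sup>2 * d1 = 4"
      by blast
    \<comment> \<open>Any member of the infinite set turns the initial solution into a good
      tuple.\<close>
    hence "{n. good_tuple (d1 + 2 * k\<^sup>2 * n) (d2 + 2 * l\<^sup>2 * n) k l} \<noteq> {}"
      using inf_odd[of d1 d2] by (intro infinite_imp_nonempty) simp
    thus ?thesis by blast
  next
    case True
    hence kl: "even k" "even l" "gcd k l = 2" "8 dvd k * l"
      using assms(3) by simp_all
    from exists_solution_even[OF this]
    obtain d1 d2 where "[d1 * d2 = 1] (mod 4)"
      "k\<^sup>2 * d2 - l\<^sup>2 * d1 = 4 \<or> k\<^sup>2 * d2 - l\<^sup>2 * d1 = - 4"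
      by blast
    hence "{n. good_tuple (d1 + k\<^sup>2 * n) (d2 + l\<^sup>2 * n) k l} \<noteq> {}"
      using kl by (intro infinite_imp_nonempty inf_even)
    thus ?thesis by blast
  qed
  moreover have "[d1 * d2 = 1] (mod 4)"
    "k\<^sup>2 * d2 - l\<^sup>2 * d1 = 4 \<or> k\<^sup>2 * d2 - l\<^sup>2 * d1 = - 4" if "good_tuple d1 d2 k l" for d1 d2
    using that unfolding good_tuple_def by blast+
  ultimately show ?thesis
    using inf_odd inf_even by blast
qed

end
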